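(* Fix an integer base $q\ge 2$. There exists a constant $c>0$ (which may depend on $q$) such that the automaticity $A(x)$ of the set of prime numbers satisfies \[A(x)\ \ge\ x\exp\left(-c(\log\log x)^2\log\log\log x\right)\] for all sufficiently large $x$.
   Context: A finite automaton over an alphabet $\mathcal{A}$ consists of a finite set $S$ of states, a starting state $s_0\in S$, a transition function $\delta:\mathcal{A}\times S\to S$ and a set $T\subseteq S$ of accepting states; a word $a_1\cdots a_n$ induces states $s_0,\dots,s_n$ with $s_{i+1}=\delta(a_{i+1},s_i)$ and is accepted iff $s_n\in T$. With $\mathcal{A}=\{0,1,\dots,q-1\}$, words are identified with nonnegative integers via the base-$q$ representation (in the paper's arguments the digits are read starting from the least significant digit). The automaticity of a set $\mathcal{X}$ of positive integers is the function $A(x)$ giving, for each $x$, the number of states of the smallest automaton which, for every integer $1\le n\le x$, accepts the base-$q$ representation of $n$ if and only if $n\in\mathcal{X}$. *)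

theory Defs
  imports Complex_Main "HOL-Computational_Algebra.Primes" "HOL-Library.Countable"
begin

record 's dfa =
  states :: "'s set"
  start :: 's
  trans :: "nat \<Rightarrow> 's \<Rightarrow> 's"
  accepting :: "'s set"

text \<open>The alphabet is \<open>{..<q}\<close>; the values of \<open>trans\<close> outside the alphabet and outside the
  state set are irrelevant.\<close>

definition is_dfa :: "nat \<Rightarrow> 's dfa \<Rightarrow> bool" where
  "is_dfa q M \<longleftrightarrow>
     finite (states M) \<and> start M \<in> states M \<and>
     (\<forall>a<q. \<forall>s\<in>states M. trans M a s \<in> states M) \<and>
     accepting M \<subseteq> states M"

definition accepts :: "'s dfa \<Rightarrow> nat list \<Rightarrow> bool" where
  "accepts M w \<longleftrightarrow> fold (trans M) w (start M) \<in> accepting M"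

text \<open>The base-\<open>q\<close> representation (without leading zeros), least significant digit first, so
  that an automaton reads the least significant digit first. The guard \<open>q < 2\<close> serves only
  termination.\<close>

function base_repr :: "nat \<Rightarrow> nat \<Rightarrow> nat list" where
  "base_repr q n = (if q < 2 \<or> n = 0 then [] else n mod q # base_repr q (n div q))"
  by pat_completeness auto
termination
  by (relation "measure snd") auto

declare base_repr.simps [simp del]

definition recognizes_upto :: "nat \<Rightarrow> 's dfa \<Rightarrow> nat set \<Rightarrow> real \<Rightarrow> bool" where
  "recognizes_upto q M X x \<longleftrightarrow>
     (\<forall>n. 1 \<le> n \<and> real n \<le> x \<longrightarrow> (accepts M (base_repr q n) \<longleftrightarrow> n \<in> X))"

text \<open>Restricting to states of type \<^typ>\<open>nat\<close> loses nothing, and the minimum is attained; see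
  \<open>automaticity_le\<close> and \<open>automaticity_attained\<close> below.\<close>

definition automaticity :: "nat \<Rightarrow> nat set \<Rightarrow> real \<Rightarrow> nat" where
  "automaticity q X x =
     (LEAST k. \<exists>M :: nat dfa. is_dfa q M \<and> recognizes_upto q M X x \<and> card (states M) = k)"

lemma horner_sum_base_repr: "q \<ge> 2 \<Longrightarrow> horner_sum id q (base_repr q n) = n"
  by (induction q n rule: base_repr.induct) (subst base_repr.simps, auto)

lemma base_repr_less: "d \<in> set (base_repr q n) \<Longrightarrow> d < q"
proof (induction q n rule: base_repr.induct)
  case (1 q n)
  then show ?case
    by (subst (asm) (2) base_repr.simps) (auto split: if_splits)
qed

lemma length_base_repr_le: "length (base_repr q n) \<le> n"
proof (induction q n rule: base_repr.induct)
  case (1 q n)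
  show ?case
  proof (cases "q < 2 \<or> n = 0")
    case False
    then have "n div q < n" and "length (base_repr q (n div q)) \<le> n div q"
      using 1 by simp_all
    with False show ?thesis by (subst base_repr.simps) simp
  qed (simp add: base_repr.simps)
qed

lemma fold_trans_in_states:
  assumes "is_dfa q M" and "set w \<subseteq> {..<q}" and "s \<in> states M"
  shows "fold (trans M) w s \<in> states M"
proof -
  have "trans M a t \<in> states M" if "a < q" "t \<in> states M" for a t
    using assms(1) that unfolding is_dfa_def by blast
  then show ?thesis
    using assms(2,3) by (induction w arbitrary: s) simp_all
qed

lemma automaticity_le:
  fixes M :: "'s dfa"
  assumes M: "is_dfa q M" and rec: "recognizes_upto q M X x"
  shows "automaticity q X x \<le> card (states M)"
proof -
  have "finite (states M)" using M by (simp add: is_dfa_def)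
  then obtain f :: "'s \<Rightarrow> nat" where f: "inj_on f (states M)"
    by (metis finite_imp_inj_to_nat_seg)
  define N :: "nat dfa" where "N = \<lparr>states = f ` states M, start = f (start M),
    trans = (\<lambda>a t. f (trans M a (inv_into (states M) f t))), accepting = f ` accepting M\<rparr>"
  have trans_N: "trans N a (f s) = f (trans M a s)" if "s \<in> states M" for a s
    using that f by (simp add: N_def)
  have trans_M: "trans M a s \<in> states M" if "a < q" "s \<in> states M" for a s
    using M that unfolding is_dfa_def by blast
  have states_N: "states N = f ` states M" "start N = f (start M)" "accepting N = f ` accepting M"
    by (simp_all add: N_def)
  have N: "is_dfa q N"
    unfolding is_dfa_def states_N
  proof (intro conjI allI impI ballI)
    fix a t assume "a < q" "t \<in> f ` states M"
    then show "trans N a t \<in> f ` states M" using trans_N trans_M by auto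
  qed (use M in \<open>simp_all add: is_dfa_def image_mono\<close>)
  have fold: "fold (trans N) w (f s) = f (fold (trans M) w s)"
    if "set w \<subseteq> {..<q}" "s \<in> states M" for w s
    using that by (induction w arbitrary: s) (simp_all add: trans_N trans_M)
  have "accepts N w \<longleftrightarrow> accepts M w" if w: "set w \<subseteq> {..<q}" for w
  proof -
    have s: "start M \<in> states M" "accepting M \<subseteq> states M" using M by (auto simp: is_dfa_def)
    have "fold (trans N) w (start N) = f (fold (trans M) w (start M))"
      using fold[OF w s(1)] by (simp add: N_def)
    moreover have "accepting N = f ` accepting M" by (simp add: N_def)
    ultimately show ?thesis
      using inj_on_image_mem_iff[OF f fold_trans_in_states[OF M w s(1)] s(2)]
      by (simp add: accepts_def)
  qed
  then have "recognizes_upto q N X x"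
    using rec base_repr_less by (simp add: recognizes_upto_def subset_iff)
  moreover have "card (states N) = card (states M)"
    using f by (simp add: N_def card_image)
  ultimately show ?thesis
    unfolding automaticity_def using N by (intro Least_le) auto
qed

lemma automaticity_attained:
  assumes q: "q \<ge> 2"
  shows "\<exists>M :: nat dfa. is_dfa q M \<and> recognizes_upto q M X x \<and>
           card (states M) = automaticity q X x"
proof -
  define L where "L = nat \<lfloor>x\<rfloor>"
  define W where "W = {w. set w \<subseteq> {..<q} \<and> length w \<le> L}"
  define M :: "nat dfa" where "M = \<lparr>states = to_nat ` W, start = to_nat ([] :: nat list),
    trans = (\<lambda>a t. if length (from_nat t :: nat list) < L
                   then to_nat (from_nat t @ [a] :: nat list) else t),
    accepting = to_nat ` (W \<inter> base_repr q ` X)\<rparr>"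
  have "finite W"
    unfolding W_def by (rule finite_lists_length_le) simp
  then have M: "is_dfa q M"
    by (auto simp: is_dfa_def M_def W_def)
  have fold: "fold (trans M) w (to_nat v) = to_nat (v @ w)" if "length v + length w \<le> L" for v w
    using that by (induction w arbitrary: v) (auto simp: M_def)
  have "recognizes_upto q M X x"
    unfolding recognizes_upto_def
  proof (intro allI impI)
    fix n :: nat assume n: "1 \<le> n \<and> real n \<le> x"
    then have "n \<le> L" unfolding L_def by linarith
    then have len: "length (base_repr q n) \<le> L"
      using length_base_repr_le[of q n] by linarith
    then have W: "base_repr q n \<in> W"
      using base_repr_less by (auto simp: W_def)
    have "fold (trans M) (base_repr q n) (start M) = to_nat (base_repr q n)"
      using fold[of "[]" "base_repr q n"] len by (simp add: M_def)
    then have "accepts M (base_repr q n) \<longleftrightarrow> base_repr q n \<in> base_repr q ` X"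
      using W by (auto simp: accepts_def M_def)
    also have "\<dots> \<longleftrightarrow> n \<in> X"
      using horner_sum_base_repr[OF q] by (metis imageE imageI)
    finally show "accepts M (base_repr q n) \<longleftrightarrow> n \<in> X" .
  qed
  with M have "\<exists>k. \<exists>M :: nat dfa. is_dfa q M \<and> recognizes_upto q M X x \<and> card (states M) = k"
    by blast
  then show ?thesis
    unfolding automaticity_def by (rule LeastI_ex)
qed

end

(*
  An automaton that has read the k least significant digits of a number knows only a state, and two
  residues r, r' < N = q^k leading to the same state have the same prime pattern: r + N n is prime
  iff r' + N n is. Let R be a set of residues with the common pattern S \<subseteq> [1, L), where L is a power of
  log x. For a small prime p, the numbers r + N n (r \<in> R, n \<in> S) avoid 0 modulo p, so S misses at
  least as many classes modulo p as R occupies. If S is not too thin, a second moment argument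
  shows that S misses few classes on average over p \<le> Q; hence R occupies few classes, and
  Gallagher's larger sieve gives |R| \<le> Q. By Chebyshev's bound a proportion >> 1 / log x of all
  residues r has a pattern that is not too thin, so the number of states is at least x / (log x)^C,
  which is more than required.
*)

theory Submission
  imports Defs "HOL-Analysis.Convex" "HOL-Number_Theory.Cong" "HOL-Real_Asymp.Real_Asymp"
begin

subsection \<open>Chebyshev's lower bound\<close>

text \<open>Legendre's formula, cut off at \<open>L\<close> because all later quotients vanish. In
  passing from \<open>n\<close> to \<open>Suc n\<close> the \<open>i\<close>-th quotient grows by
  one exactly when \<open>p ^ i\<close> divides \<open>Suc n\<close>, which happens for as many
  \<open>i\<close> as the multiplicity of \<open>p\<close> in \<open>Suc n\<close>.\<close>

lemma multiplicity_fact_eq_sum: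
  assumes p: "prime (p::nat)" and "n < p ^ Suc L"
  shows "multiplicity p (fact n :: nat) = (\<Sum>i=1..L. n div p ^ i)"
  using assms(2)
proof (induction n)
  case (Suc n)
  define m where "m = multiplicity p (Suc n)"
  have "p ^ m \<le> Suc n"
    unfolding m_def by (intro dvd_imp_le multiplicity_dvd) simp
  then have "p ^ m < p ^ Suc L" using Suc.prems by linarith
  then have "m < Suc L" using prime_gt_1_nat[OF p] by (rule power_less_imp_less_exp[rotated])
  then have "m \<le> L" by simp
  have "(p ^ i dvd Suc n) \<longleftrightarrow> i \<le> m" for i
    unfolding m_def using p by (intro power_dvd_iff_le_multiplicity) auto
  then have step: "Suc n div p ^ i = n div p ^ i + (if i \<le> m then 1 else 0)" for i
    by (simp add: div_Suc dvd_eq_mod_eq_0)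
  have "(\<Sum>i=1..L. Suc n div p ^ i) = (\<Sum>i=1..L. n div p ^ i) + (\<Sum>i=1..L. if i \<le> m then 1 else 0)"
    unfolding step by (simp add: sum.distrib)
  also have "(\<Sum>i=1..L. if i \<le> m then 1 else 0) = card {i\<in>{1..L}. i \<le> m}"
    by (simp only: card_eq_sum sum.inter_filter finite_atLeastAtMost)
  also have "{i\<in>{1..L}. i \<le> m} = {1..m}" using \<open>m \<le> L\<close> by auto
  finally have "(\<Sum>i=1..L. Suc n div p ^ i) = (\<Sum>i=1..L. n div p ^ i) + m" by simp
  moreover have "multiplicity p (fact (Suc n) :: nat) = m + multiplicity p (fact n :: nat)"
    unfolding fact_Suc m_def of_nat_id using p
    by (intro prime_elem_multiplicity_mult_distrib) (auto simp: prime_imp_prime_elem)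
  ultimately show ?case using Suc by simp
qed simp

text \<open>By Legendre's formula the exponent of \<open>p\<close> is the sum over \<open>i\<close>
  of \<open>2 * n div p ^ i - 2 * (n div p ^ i)\<close>. Each term is at most 1, and only the
  \<open>L\<close> values of \<open>i\<close> with \<open>p ^ i \<le> 2 * n\<close> count.\<close>

lemma prime_power_multiplicity_central_binomial_le:
  assumes p: "prime (p::nat)" and n: "n > 0"
  shows "p ^ multiplicity p ((2 * n) choose n) \<le> 2 * n"
proof -
  obtain L where L: "p ^ L \<le> 2 * n" "2 * n < p ^ Suc L"
    using ex_power_ivl1[of p "2 * n"] prime_ge_2_nat[OF p] n by auto
  let ?b = "(2 * n) choose n"
  have "fact n * fact (2 * n - n) * ?b = (fact (2 * n) :: nat)"
    by (intro binomial_fact_lemma) simp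
  then have "(fact (2 * n) :: nat) = fact n * (fact n * ?b)" by simp
  then have "multiplicity p (fact (2 * n) :: nat) =
      multiplicity p (fact n :: nat) + (multiplicity p (fact n :: nat) + multiplicity p ?b)"
    using p by (simp add: prime_elem_multiplicity_mult_distrib prime_imp_prime_elem)
  moreover have "multiplicity p (fact (2 * n) :: nat) = (\<Sum>i=1..L. 2 * n div p ^ i)"
    by (rule multiplicity_fact_eq_sum[OF p L(2)])
  moreover have "multiplicity p (fact n :: nat) = (\<Sum>i=1..L. n div p ^ i)"
    using L(2) by (intro multiplicity_fact_eq_sum[OF p]) linarith
  moreover have "(\<Sum>i=1..L. 2 * n div p ^ i) \<le> (\<Sum>i=1..L. 2 * (n div p ^ i) + 1)"
  proof (intro sum_mono)
    fix i
    have "n < (n div p ^ i + 1) * p ^ i"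
      using prime_gt_0_nat[OF p] dividend_less_div_times[of "p ^ i" n] by (simp add: add.commute)
    then have "2 * n < (2 * (n div p ^ i) + 2) * p ^ i" by (simp add: algebra_simps)
    then have "2 * n div p ^ i < 2 * (n div p ^ i) + 2"
      by (intro less_mult_imp_div_less)
    then show "2 * n div p ^ i \<le> 2 * (n div p ^ i) + 1" by simp
  qed
  moreover have "(\<Sum>i=1..L. 2 * (n div p ^ i) + 1) = 2 * (\<Sum>i=1..L. n div p ^ i) + L"
    by (simp add: sum.distrib sum_distrib_left del: One_nat_def)
  ultimately have "multiplicity p ?b \<le> L" by linarith
  then have "p ^ multiplicity p ?b \<le> p ^ L"
    using prime_gt_0_nat[OF p] by (intro power_increasing) auto
  with L show ?thesis by linarith
qed

text \<open>The central binomial coefficient is at least \<open>4 ^ n / (2 * n)\<close>, and it is a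
  product of at most \<pi>(N) prime powers, none exceeding \<open>N\<close>. The extra factor
  \<open>N\<close> in the bound absorbs the denominator \<open>2 * n\<close>.\<close>

lemma chebyshev_lower:
  assumes "N \<ge> 2"
  shows "2 ^ (N - 1) \<le> N ^ (card {p. prime p \<and> p \<le> N} + 1)"
proof -
  define n where "n = N div 2"
  have n: "n > 0" "2 * n \<le> N" "N - 1 \<le> 2 * n" using assms unfolding n_def by linarith+
  let ?b = "(2 * n) choose n" and ?P = "{p. prime p \<and> p \<le> N}"
  have fin: "finite ?P" by simp
  have b: "?b > 0" by (simp add: zero_less_binomial)
  have sub: "prime_factors ?b \<subseteq> ?P"
  proof
    fix p assume p: "p \<in> prime_factors ?b"
    then have "p ^ 1 \<le> p ^ multiplicity p ?b"
      by (intro power_increasing) (auto simp: prime_factors_multiplicity prime_gt_0_nat Suc_le_eq)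
    also have "\<dots> \<le> 2 * n"
      using p n by (intro prime_power_multiplicity_central_binomial_le) auto
    finally show "p \<in> ?P" using p n by auto
  qed
  have "?b = (\<Prod>p\<in>prime_factors ?b. p ^ multiplicity p ?b)"
    using b by (intro prime_factorization_nat) simp
  also have "\<dots> \<le> (\<Prod>p\<in>prime_factors ?b. N)"
    using n by (intro prod_mono) (auto intro!: order_trans[OF prime_power_multiplicity_central_binomial_le])
  also have "\<dots> = N ^ card (prime_factors ?b)" by simp
  also have "\<dots> \<le> N ^ card ?P"
    using assms by (intro power_increasing card_mono sub fin) auto
  finally have b_le: "?b \<le> N ^ card ?P" .
  have "real (4 ^ n) \<le> real ?b * (2 * real n)"
    using central_binomial_lower_bound[OF n(1)] n(1) by (simp add: field_simps)
  then have "real (4 ^ n) \<le> real (?b * (2 * n))" by simp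
  then have "4 ^ n \<le> ?b * (2 * n)" by (simp only: of_nat_le_iff)
  also have "\<dots> \<le> N ^ card ?P * N" using b_le n by (intro mult_mono) auto
  finally have "(2::nat) ^ (2 * n) \<le> N ^ (card ?P + 1)"
    by (simp add: power_mult mult.commute power2_eq_square flip: power_mult_distrib)
  moreover have "(2::nat) ^ (N - 1) \<le> 2 ^ (2 * n)" using n by (intro power_increasing) auto
  ultimately show ?thesis by linarith
qed

text \<open>Chebyshev's bound \<pi>(x) >> x / log x at \<open>x = q ^ K\<close>, without logarithms:
  the estimate \<open>q \<le> 2 ^ q\<close> turns both sides into powers of 2, whose exponents are
  compared.\<close>

lemma card_primes_le_power_ge:
  assumes "q \<ge> 2" "K \<ge> 1"
  shows "q ^ K \<le> K * q * (card {p. prime p \<and> p \<le> q ^ K} + 1) + 1"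
proof -
  let ?c = "card {p. prime p \<and> p \<le> q ^ K} + 1"
  have "q ^ 1 \<le> q ^ K" using assms by (intro power_increasing) auto
  then have "2 ^ (q ^ K - 1) \<le> (q ^ K) ^ ?c"
    using assms by (intro chebyshev_lower) simp
  also have "\<dots> = q ^ (K * ?c)" by (simp only: power_mult)
  also have "\<dots> \<le> (2 ^ q) ^ (K * ?c)"
    by (intro power_mono) (simp_all add: less_imp_le)
  also have "\<dots> = 2 ^ (q * (K * ?c))" by (simp only: power_mult)
  finally have "q ^ K - 1 \<le> q * (K * ?c)" by simp
  then show ?thesis by (simp add: algebra_simps)
qed

subsection \<open>Counting in residue classes\<close>

lemma card_le_of_same_residue:
  assumes "T \<subseteq> {..<M::nat}" and "\<And>n n'. n \<in> T \<Longrightarrow> n' \<in> T \<Longrightarrow> n mod m = n' mod m"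
  shows "card T \<le> M div m + 1"
proof -
  have "inj_on (\<lambda>n. n div m) T"
    by (intro inj_onI) (metis assms(2) div_mult_mod_eq)
  then have "card T = card ((\<lambda>n. n div m) ` T)" by (simp add: card_image)
  also have "\<dots> \<le> card {..M div m}"
    using assms(1) by (intro card_mono) (auto intro!: div_le_mono)
  finally show ?thesis by simp
qed

lemma card_residue_class_ge:
  assumes "a < m"
  shows "M div m \<le> card {n\<in>{..<M::nat}. n mod m = a}"
proof -
  have "inj_on (\<lambda>i. i * m + a) {..<M div m}"
    using assms by (intro inj_onI) auto
  then have "M div m = card ((\<lambda>i. i * m + a) ` {..<M div m})" by (simp add: card_image)
  also have "\<dots> \<le> card {n\<in>{..<M::nat}. n mod m = a}"
  proof (intro card_mono subsetI)
    fix n assume "n \<in> (\<lambda>i. i * m + a) ` {..<M div m}"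
    then obtain i where i: "i < M div m" "n = i * m + a" by auto
    then have "n < (i + 1) * m" using assms by simp
    also have "\<dots> \<le> (M div m) * m" using i by (intro mult_right_mono) auto
    also have "\<dots> \<le> M" by simp
    finally show "n \<in> {n\<in>{..<M::nat}. n mod m = a}" using i assms by simp
  qed simp
  finally show ?thesis .
qed

lemma real_div_bounds:
  fixes m M :: nat
  assumes "m > 0"
  shows "real (M div m) \<le> M / m" "M / m - 1 \<le> real (M div m)"
proof -
  have "M = M div m * m + M mod m" "M mod m < m" using assms by simp_all
  then have "real M = real (M div m) * real m + real (M mod m)" "real (M mod m) < real m"
    by (metis of_nat_add of_nat_mult) (simp add: assms)
  then show "real (M div m) \<le> M / m" "M / m - 1 \<le> real (M div m)"
    using assms by (simp_all add: field_simps)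
qed

lemma card_mod_mem:
  fixes m M :: nat
  assumes m: "m > 0" and A: "A \<subseteq> {..<m}"
  shows "card {n\<in>{..<M::nat}. n mod m \<in> A} \<le> card A * (M / m + 1)"
    and "card A * (M / m - 1) \<le> card {n\<in>{..<M::nat}. n mod m \<in> A}"
proof -
  have fin: "finite A" by (rule finite_subset[OF A]) simp
  have U: "{n\<in>{..<M::nat}. n mod m \<in> A} = (\<Union>a\<in>A. {n\<in>{..<M}. n mod m = a})" by auto
  have "card {n\<in>{..<M::nat}. n mod m \<in> A} = (\<Sum>a\<in>A. card {n\<in>{..<M}. n mod m = a})"
    unfolding U using fin by (intro card_UN_disjoint) auto
  then have eq: "real (card {n\<in>{..<M::nat}. n mod m \<in> A}) = (\<Sum>a\<in>A. real (card {n\<in>{..<M}. n mod m = a}))"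
    by simp
  have "(\<Sum>a\<in>A. real (card {n\<in>{..<M}. n mod m = a})) \<le> (\<Sum>a\<in>A. M / m + 1)"
  proof (intro sum_mono)
    fix a
    have "card {n\<in>{..<M}. n mod m = a} \<le> M div m + 1"
      by (intro card_le_of_same_residue) auto
    then show "real (card {n\<in>{..<M}. n mod m = a}) \<le> M / m + 1"
      using real_div_bounds[OF m, of M] by linarith
  qed
  then show "card {n\<in>{..<M::nat}. n mod m \<in> A} \<le> card A * (M / m + 1)" unfolding eq by simp
  have "(\<Sum>a\<in>A. M / m - 1) \<le> (\<Sum>a\<in>A. real (card {n\<in>{..<M}. n mod m = a}))"
  proof (intro sum_mono)
    fix a assume "a \<in> A"
    then have "M div m \<le> card {n\<in>{..<M}. n mod m = a}"
      using A by (intro card_residue_class_ge) auto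
    then show "M / m - 1 \<le> real (card {n\<in>{..<M}. n mod m = a})"
      using real_div_bounds[OF m, of M] by linarith
  qed
  then show "card A * (M / m - 1) \<le> card {n\<in>{..<M::nat}. n mod m \<in> A}" unfolding eq by simp
qed

text \<open>Coprimality merges the two congruences into one modulo \<open>m * m'\<close>, so each
  pair of residues contributes at most one class. This is the near independence of distinct primes
  on which the second moment rests.\<close>

lemma card_mod_mem_pair_le:
  fixes m m' M :: nat
  assumes "coprime m m'" "m > 0" "m' > 0" and A: "finite A" "finite A'"
  shows "card {n\<in>{..<M::nat}. n mod m \<in> A \<and> n mod m' \<in> A'} \<le> card A * card A' * (M / (m * m') + 1)"
proof -
  let ?T = "\<lambda>x. {n\<in>{..<M}. n mod m = fst x \<and> n mod m' = snd x}"
  have "{n\<in>{..<M::nat}. n mod m \<in> A \<and> n mod m' \<in> A'} = (\<Union>x\<in>A\<times>A'. ?T x)" by auto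
  then have "card {n\<in>{..<M::nat}. n mod m \<in> A \<and> n mod m' \<in> A'} \<le> (\<Sum>x\<in>A\<times>A'. card (?T x))"
    using card_UN_le[of "A\<times>A'" ?T] A by simp
  also have "real (\<Sum>x\<in>A\<times>A'. card (?T x)) \<le> (\<Sum>x\<in>A\<times>A'. M / (m * m') + 1)"
    unfolding of_nat_sum
  proof (intro sum_mono)
    fix x :: "nat \<times> nat"
    have "card (?T x) \<le> M div (m * m') + 1"
    proof (intro card_le_of_same_residue)
      fix n n' assume "n \<in> ?T x" "n' \<in> ?T x"
      then have "[n = n'] (mod m)" "[n = n'] (mod m')" by (auto simp: unique_euclidean_semiring_class.cong_def)
      then have "[n = n'] (mod m * m')" using assms(1) by (intro coprime_cong_mult_nat)
      then show "n mod (m * m') = n' mod (m * m')" by (simp add: unique_euclidean_semiring_class.cong_def)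
    qed auto
    then show "real (card (?T x)) \<le> M / (m * m') + 1"
      using real_div_bounds[of "m * m'" M] assms by simp
  qed
  also have "\<dots> = card A * card A' * (M / (m * m') + 1)" by (simp add: card_cartesian_product)
  finally show ?thesis by simp
qed

subsection \<open>A second moment sieve\<close>

text \<open>Let \<open>F n\<close> count the \<open>p\<close> in \<open>P\<close> with
  \<open>n mod p\<close> in \<open>A p\<close>. On average over \<open>n < M\<close> it is about
  \<mu>, the sum of \<open>card (A p) / p\<close>, but it vanishes on \<open>S\<close>, so every
  element of \<open>S\<close> contributes \<mu>^2 to the sum of
  \<open>(F n - \<mu>)\<^sup>2\<close>. As in Turan's method that sum is about
  \<open>M * \<mu>\<close>, and \<open>Q ^ 3 \<le> M\<close> keeps the rounding errors below a
  multiple of \<open>M\<close>.\<close>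

lemma variance_sieve:
  fixes P S :: "nat set" and A :: "nat \<Rightarrow> nat set" and Q M :: nat
  assumes P: "\<And>p. p \<in> P \<Longrightarrow> prime p" "P \<subseteq> {1..Q}"
    and A: "\<And>p. p \<in> P \<Longrightarrow> A p \<subseteq> {..<p}"
    and S: "S \<subseteq> {..<M}" "\<And>n p. n \<in> S \<Longrightarrow> p \<in> P \<Longrightarrow> n mod p \<notin> A p"
    and Q: "Q ^ 3 \<le> M"
  shows "card S * (\<Sum>p\<in>P. card (A p) / p) \<le> 5 * M"
proof (cases "(\<Sum>p\<in>P. real (card (A p)) / p) = 0 \<or> Q = 0")
  case True
  then show ?thesis using P by auto
next
  case False
  define \<mu> where "\<mu> = (\<Sum>p\<in>P. real (card (A p)) / p)"
  \<comment> \<open>\<open>V\<close> measures rounding: replacing each count \<open>c p\<close> by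
    its expected value costs at most \<open>card (A p)\<close>.\<close>
  define V where "V = (\<Sum>p\<in>P. real (card (A p)))"
  define c where "c p = real (card {n\<in>{..<M}. n mod p \<in> A p})" for p
  define d where "d p p' = real (card {n\<in>{..<M}. n mod p \<in> A p \<and> n mod p' \<in> A p'})" for p p'
  define F where "F n = (\<Sum>p\<in>P. if n mod p \<in> A p then 1 else 0 :: real)" for n
  have finP: "finite P" using P(2) finite_subset by blast
  have finA: "finite (A p)" if "p \<in> P" for p
    by (rule finite_subset[OF A[OF that]]) simp
  have pos: "p > 0" if "p \<in> P" for p using P(2) that by auto
  have \<mu>_pos: "\<mu> > 0"
    using False sum_nonneg[of P "\<lambda>p. real (card (A p)) / p"] unfolding \<mu>_def by simp
  have V_nonneg: "V \<ge> 0" unfolding V_def by (simp add: sum_nonneg)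
  have V_le: "V \<le> Q * \<mu>"
    unfolding V_def \<mu>_def sum_distrib_left
  proof (intro sum_mono)
    fix p assume p: "p \<in> P"
    then have "card (A p) * p \<le> card (A p) * Q" using P(2) by auto
    then have "real (card (A p)) * real p \<le> real (card (A p)) * real Q"
      by (metis of_nat_le_iff of_nat_mult)
    then show "real (card (A p)) \<le> real Q * (real (card (A p)) / real p)"
      using pos[OF p] by (simp add: field_simps)
  qed
  have "\<mu> \<le> (\<Sum>p\<in>P. 1)"
    unfolding \<mu>_def
  proof (intro sum_mono)
    fix p assume p: "p \<in> P"
    have "card (A p) \<le> card {..<p}" by (intro card_mono A p) simp
    then show "real (card (A p)) / real p \<le> 1" using pos[OF p] by simp
  qed
  also have "\<dots> = real (card P)" by simp
  also have "card P \<le> card {1..Q}" by (intro card_mono P) simp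
  finally have \<mu>_le: "\<mu> \<le> Q" by simp
  have sumF: "(\<Sum>n<M. F n) = (\<Sum>p\<in>P. c p)"
    unfolding F_def c_def by (subst sum.swap) (simp add: sum.If_cases Int_def)
  have sumF2: "(\<Sum>n<M. (F n)\<^sup>2) = (\<Sum>p\<in>P. \<Sum>p'\<in>P. d p p')"
  proof -
    have "(F n)\<^sup>2 = (\<Sum>p\<in>P. \<Sum>p'\<in>P. if n mod p \<in> A p \<and> n mod p' \<in> A p' then 1 else 0 :: real)" for n
      unfolding F_def power2_eq_square sum_product by (intro sum.cong refl) auto
    then have "(\<Sum>n<M. (F n)\<^sup>2) =
        (\<Sum>n<M. \<Sum>p\<in>P. \<Sum>p'\<in>P. if n mod p \<in> A p \<and> n mod p' \<in> A p' then 1 else 0 :: real)"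
      by simp
    also have "\<dots> = (\<Sum>p\<in>P. \<Sum>n<M. \<Sum>p'\<in>P. if n mod p \<in> A p \<and> n mod p' \<in> A p' then 1 else 0 :: real)"
      by (rule sum.swap)
    also have "\<dots> = (\<Sum>p\<in>P. \<Sum>p'\<in>P. \<Sum>n<M. if n mod p \<in> A p \<and> n mod p' \<in> A p' then 1 else 0 :: real)"
      by (rule sum.cong[OF refl], rule sum.swap)
    also have "\<dots> = (\<Sum>p\<in>P. \<Sum>p'\<in>P. d p p')"
      unfolding d_def by (intro sum.cong refl) (simp add: sum.If_cases Int_def)
    finally show ?thesis .
  qed
  have sumF_ge: "(\<Sum>p\<in>P. c p) \<ge> M * \<mu> - V"
  proof -
    have "M * \<mu> - V = (\<Sum>p\<in>P. card (A p) * (M / p - 1))"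
      unfolding \<mu>_def V_def by (simp add: sum_distrib_left algebra_simps sum_subtractf)
    also have "\<dots> \<le> (\<Sum>p\<in>P. c p)"
      unfolding c_def by (intro sum_mono card_mod_mem(2) pos A)
    finally show ?thesis .
  qed
  \<comment> \<open>Distinct primes are nearly independent. On the diagonal \<open>d p p\<close> is
    a single count, of first rather than second order in \<mu>, and is added separately.\<close>
  have "(\<Sum>p\<in>P. \<Sum>p'\<in>P. d p p') \<le>
      (\<Sum>p\<in>P. \<Sum>p'\<in>P. card (A p) * card (A p') * (M / (p * p') + 1) +
         (if p' = p then card (A p) * (M / p + 1) else 0))"
  proof (intro sum_mono)
    fix p p' assume p: "p \<in> P" "p' \<in> P"
    show "d p p' \<le> card (A p) * card (A p') * (M / (p * p') + 1) +
         (if p' = p then card (A p) * (M / p + 1) else 0)"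
    proof (cases "p' = p")
      case True
      have "d p p' \<le> card (A p) * (M / p + 1)"
        using card_mod_mem(1)[of p "A p" M] pos[of p] A[of p] p unfolding True d_def by simp
      then show ?thesis using True by (simp add: add_increasing)
    next
      case False
      then have "coprime p p'" using P(1) p by (metis primes_coprime)
      then have "d p p' \<le> card (A p) * card (A p') * (M / (p * p') + 1)"
        unfolding d_def using p finA pos by (intro card_mod_mem_pair_le) auto
      then show ?thesis using False by simp
    qed
  qed
  also have "\<dots> = (\<Sum>p\<in>P. \<Sum>p'\<in>P. card (A p) * card (A p') * (M / (p * p') + 1)) +
      (\<Sum>p\<in>P. card (A p) * (M / p + 1))"
    using finP by (simp add: sum.distrib)
  also have "(\<Sum>p\<in>P. card (A p) * (M / p + 1)) = M * \<mu> + V"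
    unfolding \<mu>_def V_def by (simp add: sum_distrib_left algebra_simps sum.distrib)
  also have "(\<Sum>p\<in>P. \<Sum>p'\<in>P. card (A p) * card (A p') * (M / (p * p') + 1)) =
      (\<Sum>p\<in>P. \<Sum>p'\<in>P. M * ((card (A p) / p) * (card (A p') / p')) + real (card (A p)) * real (card (A p')))"
    by (intro sum.cong refl) (simp add: field_simps)
  also have "\<dots> = M * \<mu>\<^sup>2 + V\<^sup>2"
    unfolding \<mu>_def V_def power2_eq_square sum_product
    by (simp only: sum.distrib sum_distrib_left)
  finally have sumF2_le: "(\<Sum>n<M. (F n)\<^sup>2) \<le> M * \<mu>\<^sup>2 + V\<^sup>2 + (M * \<mu> + V)"
    unfolding sumF2 by simp
  have "card S * \<mu>\<^sup>2 = (\<Sum>n\<in>S. (F n - \<mu>)\<^sup>2)"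
    using S(2) by (simp add: F_def)
  also have "\<dots> \<le> (\<Sum>n<M. (F n - \<mu>)\<^sup>2)"
    using S(1) by (intro sum_mono2) auto
  also have "\<dots> = (\<Sum>n<M. (F n)\<^sup>2) - 2 * \<mu> * (\<Sum>n<M. F n) + M * \<mu>\<^sup>2"
    by (simp add: power2_diff sum.distrib sum_subtractf sum_distrib_left mult_ac)
  also have "\<dots> \<le> (M * \<mu>\<^sup>2 + V\<^sup>2 + (M * \<mu> + V)) - 2 * \<mu> * (M * \<mu> - V) + M * \<mu>\<^sup>2"
    using sumF2_le sumF_ge \<mu>_pos unfolding sumF by (intro add_mono diff_mono mult_left_mono) auto
  \<comment> \<open>The three main terms \<open>M * \<mu>\<^sup>2\<close>, with coefficients 1, -2
    and 1, cancel.\<close>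
  also have "\<dots> = M * \<mu> + V + V\<^sup>2 + 2 * \<mu> * V"
    by (simp add: power2_eq_square algebra_simps)
  also have "\<dots> \<le> M * \<mu> + Q * \<mu> + (Q * \<mu>)\<^sup>2 + 2 * \<mu> * (Q * \<mu>)"
    using V_le V_nonneg \<mu>_pos by (intro add_mono mult_left_mono power_mono) auto
  also have "\<dots> = \<mu> * (M + Q + Q\<^sup>2 * \<mu> + 2 * Q * \<mu>)"
    by (simp add: power2_eq_square algebra_simps)
  finally have "\<mu> * (card S * \<mu>) \<le> \<mu> * (M + Q + Q\<^sup>2 * \<mu> + 2 * Q * \<mu>)"
    by (simp add: power2_eq_square algebra_simps)
  then have "card S * \<mu> \<le> M + Q + Q\<^sup>2 * \<mu> + 2 * Q * \<mu>" using \<mu>_pos by simp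
  \<comment> \<open>One factor \<mu> has been cancelled. Since \<mu> is at most \<open>Q\<close>,
    the errors \<open>Q\<close>, \<open>Q ^ 3\<close> and \<open>2 * Q\<^sup>2\<close> sum to at
    most \<open>4 * Q ^ 3\<close>, hence the constant 5.\<close>
  also have "\<dots> \<le> M + Q + (real Q)\<^sup>2 * Q + 2 * Q * real Q"
    using mult_left_mono[OF \<mu>_le, of "(real Q)\<^sup>2"] mult_left_mono[OF \<mu>_le, of "2 * real Q"] by simp
  also have "\<dots> \<le> M + 4 * real Q ^ 3"
  proof -
    have "real Q \<ge> 1" using False by simp
    then have "real Q ^ 1 \<le> real Q ^ 3" "real Q ^ 2 \<le> real Q ^ 3"
      by (intro power_increasing; simp)+
    then show ?thesis by (simp add: power2_eq_square power3_eq_cube)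
  qed
  also have "real Q ^ 3 \<le> real M" using Q by (metis of_nat_le_iff of_nat_power)
  finally show ?thesis by (simp add: \<mu>_def)
qed

subsection \<open>Gallagher's larger sieve\<close>

text \<open>Every prime factor is at least 2, so a number with \<open>m\<close> distinct prime
  factors is at least \<open>2 ^ m\<close>.\<close>

lemma card_prime_divisors_le:
  fixes d D :: nat
  assumes "\<And>p. p \<in> P \<Longrightarrow> prime p" "d > 0" "d \<le> 2 ^ D"
  shows "card {p\<in>P. p dvd d} \<le> D"
proof -
  have "{p\<in>P. p dvd d} \<subseteq> prime_factors d"
    using assms by (auto simp: prime_factors_dvd)
  then have "card {p\<in>P. p dvd d} \<le> card (prime_factors d)" by (intro card_mono) auto
  also have "\<dots> \<le> D"
  proof -
    have "2 ^ card (prime_factors d) = (\<Prod>p\<in>prime_factors d. 2::nat)" by simp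
    also have "\<dots> \<le> (\<Prod>p\<in>prime_factors d. p ^ multiplicity p d)"
    proof (intro prod_mono conjI)
      fix p assume p: "p \<in> prime_factors d"
      then have "2 \<le> p ^ 1" by (auto intro: prime_ge_2_nat)
      also have "\<dots> \<le> p ^ multiplicity p d"
        using p by (intro power_increasing) (auto simp: prime_factors_multiplicity prime_gt_0_nat Suc_le_eq)
      finally show "2 \<le> p ^ multiplicity p d" .
    qed simp
    also have "\<dots> = d" using assms by (intro prime_factorization_nat[symmetric]) simp
    finally have "(2::nat) ^ card (prime_factors d) \<le> 2 ^ D" using assms by linarith
    then show ?thesis by simp
  qed
  finally show ?thesis .
qed

text \<open>Double counting of triples \<open>(p, r, r')\<close> with \<open>r\<close> and
  \<open>r'\<close> congruent modulo \<open>p\<close>. From below, Cauchy-Schwarz over the classes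
  occupied by \<open>R\<close> gives the square of \<open>card R\<close> divided by their number.
  From above, a pair \<open>r = r'\<close> serves all of \<open>P\<close>, while a nonzero
  difference below \<open>2 ^ D\<close> has at most \<open>D\<close> prime divisors. A factor
  \<open>card R\<close> then cancels.\<close>

lemma larger_sieve:
  fixes P R :: "nat set" and D :: nat
  assumes P: "finite P" "\<And>p. p \<in> P \<Longrightarrow> prime p"
    and R: "R \<subseteq> {..<2 ^ D}" "R \<noteq> {}"
  shows "card R * (\<Sum>p\<in>P. 1 / card ((\<lambda>r. r mod p) ` R)) \<le> card P + card R * D"
proof -
  have finR: "finite R" by (rule finite_subset[OF R(1)]) simp
  then have cR: "card R > 0" using R(2) by (simp add: card_gt_0_iff)
  define f where "f p a = real (card {r\<in>R. r mod p = a})" for p a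
  \<comment> \<open>The right-hand side is the number of pairs in \<open>R\<close> congruent modulo
    \<open>p\<close>, since \<open>f p (r mod p)\<close> is the size of the class of
    \<open>r\<close>.\<close>
  have fiber: "(card R)\<^sup>2 / card ((\<lambda>r. r mod p) ` R) \<le> (\<Sum>r\<in>R. f p (r mod p))" for p
  proof -
    let ?I = "(\<lambda>r. r mod p) ` R"
    have "real (card R) = (\<Sum>r\<in>R. 1)" by simp
    also have "\<dots> = (\<Sum>a\<in>?I. \<Sum>r\<in>{r\<in>R. r mod p = a}. 1)"
      by (rule sum.image_gen[OF finR])
    also have "\<dots> = (\<Sum>a\<in>?I. f p a)" by (simp add: f_def)
    finally have "(real (card R))\<^sup>2 \<le> (\<Sum>a\<in>?I. (f p a)\<^sup>2) * card ?I"
      using sum_squared_le_sum_of_squares[of "f p" ?I] by simp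
    also have "(\<Sum>a\<in>?I. (f p a)\<^sup>2) = (\<Sum>a\<in>?I. \<Sum>r\<in>{r\<in>R. r mod p = a}. f p (r mod p))"
    proof (intro sum.cong refl)
      fix a
      have "(\<Sum>r\<in>{r\<in>R. r mod p = a}. f p (r mod p)) = (\<Sum>r\<in>{r\<in>R. r mod p = a}. f p a)"
        by (intro sum.cong) auto
      then show "(f p a)\<^sup>2 = (\<Sum>r\<in>{r\<in>R. r mod p = a}. f p (r mod p))"
        by (simp add: f_def power2_eq_square)
    qed
    also have "\<dots> = (\<Sum>r\<in>R. f p (r mod p))" by (rule sum.image_gen[OF finR, symmetric])
    finally show ?thesis
      using finR R(2) by (simp add: divide_le_eq card_gt_0_iff)
  qed
  have "(card R)\<^sup>2 * (\<Sum>p\<in>P. 1 / card ((\<lambda>r. r mod p) ` R)) \<le> (\<Sum>p\<in>P. \<Sum>r\<in>R. f p (r mod p))"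
    unfolding sum_distrib_left using fiber by (intro sum_mono) simp
  also have "\<dots> = (\<Sum>p\<in>P. \<Sum>r\<in>R. \<Sum>r'\<in>R. if r' mod p = r mod p then 1 else 0)"
    using finR by (simp add: f_def sum.If_cases Int_def)
  also have "\<dots> = (\<Sum>r\<in>R. \<Sum>p\<in>P. \<Sum>r'\<in>R. if r' mod p = r mod p then 1 else 0)"
    by (rule sum.swap)
  also have "\<dots> = (\<Sum>r\<in>R. \<Sum>r'\<in>R. \<Sum>p\<in>P. if r' mod p = r mod p then 1 else 0)"
    by (rule sum.cong[OF refl], rule sum.swap)
  also have "\<dots> = (\<Sum>r\<in>R. \<Sum>r'\<in>R. real (card {p\<in>P. r' mod p = r mod p}))"
    using P(1) by (simp add: sum.If_cases Int_def)
  also have "\<dots> \<le> (\<Sum>r\<in>R. \<Sum>r'\<in>R. (if r' = r then real (card P) else 0) + D)"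
  proof (intro sum_mono)
    fix r r' assume r: "r \<in> R" "r' \<in> R"
    show "real (card {p\<in>P. r' mod p = r mod p}) \<le> (if r' = r then real (card P) else 0) + D"
    proof (cases "r' = r")
      case False
      \<comment> \<open>Subtraction is truncated, so one summand is 0 and \<open>d\<close> is the
        absolute difference.\<close>
      define d where "d = (r - r') + (r' - r)"
      have "r < 2 ^ D" "r' < 2 ^ D" using r R(1) by auto
      then have d: "d > 0" "d \<le> 2 ^ D" using False unfolding d_def by linarith+
      have "{p\<in>P. r' mod p = r mod p} \<subseteq> {p\<in>P. p dvd d}"
      proof clarsimp
        fix p assume "r' mod p = r mod p"
        then have "int p dvd int r - int r'"
          by (metis mod_eq_dvd_iff of_nat_mod)
        moreover have "int d = int r - int r' \<or> int d = - (int r - int r')"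
          unfolding d_def by linarith
        ultimately have "int p dvd int d" by (metis dvd_minus_iff)
        then show "p dvd d" by simp
      qed
      then have "card {p\<in>P. r' mod p = r mod p} \<le> card {p\<in>P. p dvd d}"
        using P(1) by (intro card_mono) auto
      moreover have "card {p\<in>P. p dvd d} \<le> D"
        using d P(2) by (intro card_prime_divisors_le) auto
      ultimately show ?thesis using False by simp
    qed simp
  qed
  also have "\<dots> = card R * card P + card R * (card R * D)"
    using finR by (simp add: sum.distrib algebra_simps)
  finally have "card R * (card R * (\<Sum>p\<in>P. 1 / card ((\<lambda>r. r mod p) ` R))) \<le> card R * (card P + card R * D)"
    by (simp add: power2_eq_square algebra_simps)
  then show ?thesis using cR by simp
qed

section \<open>Residues with many common prime translates\<close>

text \<open>For each \<open>p\<close> the set \<open>S\<close> avoids the classes \<open>b\<close>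
  that solve \<open>r + g * b = 0\<close> modulo \<open>p\<close> for some \<open>r\<close> in
  \<open>R\<close>, and there are at least as many of these as classes occupied by \<open>R\<close>.
  If \<open>S\<close> is large, the variance sieve makes their number \<nu>(p) small on average,
  Cauchy-Schwarz makes the sum of 1/\<nu>(p) large, and the larger sieve bounds \<open>R\<close>.
  The hypothesis \<open>large\<close> is exactly what makes that sum at least
  \<open>D + 1\<close>.\<close>

lemma card_common_prime_translates_le:
  fixes P R S :: "nat set" and g D Q M :: nat
  assumes P: "\<And>p. p \<in> P \<Longrightarrow> prime p" "P \<subseteq> {1..Q}" "\<And>p. p \<in> P \<Longrightarrow> coprime g p"
    and Q: "Q > 0" "Q ^ 3 \<le> M" "Q \<le> g"
    and R: "R \<subseteq> {..<2 ^ D}"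
    and S: "S \<subseteq> {1..<M}"
    and prime: "\<And>r n. r \<in> R \<Longrightarrow> n \<in> S \<Longrightarrow> prime (r + g * n)"
    and large: "5 * Q * M * (D + 1) \<le> (card P)\<^sup>2 * card S" "M > 0"
  shows "card R \<le> Q"
proof (cases "R = {} \<or> S = {}")
  case True
  then show ?thesis using large Q by auto
next
  case False
  have finP: "finite P" by (rule finite_subset[OF P(2)]) simp
  have finR: "finite R" by (rule finite_subset[OF R]) simp
  define A where "A p = {b\<in>{..<p}. \<exists>r\<in>R. p dvd r + g * b}" for p
  define \<nu> where "\<nu> p = real (card (A p))" for p
  have miss: "n mod p \<notin> A p" if "n \<in> S" "p \<in> P" for n p
  proof
    assume "n mod p \<in> A p"
    then obtain r where r: "r \<in> R" "p dvd r + g * (n mod p)" by (auto simp: A_def)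
    then have "(r + g * (n mod p)) mod p = 0" by simp
    then have "(r + g * n) mod p = 0" by (metis mod_add_right_eq mod_mult_right_eq)
    then have "p dvd r + g * n" by (simp add: dvd_eq_mod_eq_0)
    \<comment> \<open>A prime divisible by \<open>p\<close> equals \<open>p\<close>. As
      \<open>p \<le> Q \<le> g \<le> g * n\<close>, this leaves only \<open>p = g\<close>, which
      coprimality of \<open>g\<close> and \<open>p\<close> excludes.\<close>
    then have "p = r + g * n" using prime[OF r(1) that(1)] P(1)[OF that(2)] by (simp add: primes_dvd_imp_eq)
    moreover have "g * n \<ge> g * 1" using that S by (intro mult_left_mono) auto
    moreover have "p \<le> Q" using P(2) that by auto
    ultimately have "p = g" using Q(3) by linarith
    then show False using P(1,3)[OF that(2)] by auto
  qed
  have \<nu>_ge: "card ((\<lambda>r. r mod p) ` R) \<le> \<nu> p" if p: "p \<in> P" for p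
  proof -
    obtain y where y: "[g * y = Suc 0] (mod p)"
      using cong_solve_coprime_nat P(3)[OF p] by blast
    have p0: "p > 0" using P(2) p by auto
    \<comment> \<open>With \<open>y\<close> the inverse of \<open>g\<close>, the class
      \<open>b = - r * y\<close> lies in \<open>A p\<close>, and \<open>- g * b\<close> recovers
      \<open>r\<close> modulo \<open>p\<close>. So the map \<open>b\<close> to
      \<open>- g * b\<close> sends \<open>A p\<close> onto a set containing all classes of
      \<open>R\<close>.\<close>
    have "(\<lambda>r. r mod p) ` R \<subseteq> (\<lambda>b. nat ((- int (g * b)) mod int p)) ` A p"
    proof clarify
      fix r assume r: "r \<in> R"
      define b where "b = nat ((- int (r * y)) mod int p)"
      have b: "int b = (- int (r * y)) mod int p" unfolding b_def using p0 by simp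
      have "[int g * int y = 1] (mod int p)" using y by (metis cong_int_iff of_nat_1 of_nat_mult One_nat_def)
      then have "[int r * (int g * int y) = int r * 1] (mod int p)" by (rule cong_scalar_left)
      moreover have "[int g * int b = int g * (- int (r * y))] (mod int p)"
        unfolding b by (intro cong_scalar_left) simp
      moreover have "int g * (- int (r * y)) = - (int r * (int g * int y))" by simp
      ultimately have c: "[int g * int b = - int r] (mod int p)"
        by (metis cong_minus_minus_iff cong_trans mult.right_neutral)
      then have "[int r + int g * int b = int r + - int r] (mod int p)" by (intro cong_add) auto
      then have "int p dvd int (r + g * b)" by (simp add: cong_0_iff)
      then have "p dvd r + g * b" by (simp only: of_nat_dvd_iff)
      moreover have "b < p" unfolding b_def using p0 by (simp add: nat_less_iff)
      ultimately have "b \<in> A p" using r by (auto simp: A_def)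
      have "nat ((- int (g * b)) mod int p) = r mod p"
      proof -
        have "[- int (g * b) = int r] (mod int p)"
          using c by (metis cong_minus_minus_iff of_nat_mult minus_minus)
        then have "(- int (g * b)) mod int p = int (r mod p)"
          by (simp add: unique_euclidean_semiring_class.cong_def zmod_int)
        then show ?thesis by simp
      qed
      then show "r mod p \<in> (\<lambda>b. nat ((- int (g * b)) mod int p)) ` A p"
        using \<open>b \<in> A p\<close> by (intro image_eqI[where x = b]) simp_all
    qed
    then have "card ((\<lambda>r. r mod p) ` R) \<le> card (A p)"
      by (rule surj_card_le[rotated]) (simp add: A_def)
    then show ?thesis by (simp add: \<nu>_def)
  qed
  have I_pos: "card ((\<lambda>r. r mod p) ` R) > 0" for p using finR False by (simp add: card_gt_0_iff)
  have \<nu>_pos: "\<nu> p > 0" if "p \<in> P" for p using \<nu>_ge[OF that] I_pos[of p] by linarith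
  have "card S * (\<Sum>p\<in>P. \<nu> p / p) \<le> 5 * M"
    unfolding \<nu>_def using P(1,2) S miss Q(2) by (intro variance_sieve) (auto simp: A_def)
  moreover have "(\<Sum>p\<in>P. \<nu> p) \<le> Q * (\<Sum>p\<in>P. \<nu> p / p)"
    unfolding sum_distrib_left
  proof (intro sum_mono)
    fix p assume p: "p \<in> P"
    then have "\<nu> p * p \<le> \<nu> p * Q" using P(2) by (intro mult_left_mono) (auto simp: \<nu>_def)
    moreover have "p > 0" using p P(2) by auto
    ultimately show "\<nu> p \<le> Q * (\<nu> p / p)" by (simp add: field_simps)
  qed
  then have "card S * (\<Sum>p\<in>P. \<nu> p) \<le> card S * (Q * (\<Sum>p\<in>P. \<nu> p / p))"
    by (intro mult_left_mono) auto
  ultimately have \<nu>_sum: "card S * (\<Sum>p\<in>P. \<nu> p) \<le> 5 * Q * M"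
    using mult_left_mono[of "card S * (\<Sum>p\<in>P. \<nu> p / p)" "5 * M" Q] by (simp add: mult_ac)
  define H where "H = (\<Sum>p\<in>P. 1 / card ((\<lambda>r. r mod p) ` R))"
  \<comment> \<open>Writing 1 as a product of square roots prepares Cauchy-Schwarz: the squared size
    of \<open>P\<close> is at most the sum of \<nu>(p) times the sum of 1/\<nu>(p).\<close>
  have "real (card P) = (\<Sum>p\<in>P. sqrt (\<nu> p) * sqrt (1 / \<nu> p))"
    using \<nu>_pos by (simp add: real_sqrt_mult[symmetric] order_less_imp_not_eq2)
  then have "(card P)\<^sup>2 \<le> (\<Sum>p\<in>P. (sqrt (\<nu> p))\<^sup>2) * (\<Sum>p\<in>P. (sqrt (1 / \<nu> p))\<^sup>2)"
    using Cauchy_Schwarz_ineq_sum[of "\<lambda>p. sqrt (\<nu> p)" "\<lambda>p. sqrt (1 / \<nu> p)" P] by simp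
  also have "\<dots> = (\<Sum>p\<in>P. \<nu> p) * (\<Sum>p\<in>P. 1 / \<nu> p)"
    using \<nu>_pos by (simp add: less_imp_le)
  also have "\<dots> \<le> (\<Sum>p\<in>P. \<nu> p) * H"
    unfolding H_def using \<nu>_pos \<nu>_ge I_pos
    by (intro mult_left_mono sum_mono divide_left_mono sum_nonneg mult_pos_pos) (auto simp: less_imp_le)
  finally have CS: "(card P)\<^sup>2 \<le> (\<Sum>p\<in>P. \<nu> p) * H" .
  have H0: "H \<ge> 0" unfolding H_def by (intro sum_nonneg) simp
  have "real (5 * Q * M * (D + 1)) \<le> real ((card P)\<^sup>2 * card S)"
    using large(1) by (simp only: of_nat_le_iff)
  also have "\<dots> \<le> (card S * (\<Sum>p\<in>P. \<nu> p)) * H"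
    using mult_left_mono[OF CS, of "card S"] by (simp add: mult_ac)
  also have "\<dots> \<le> (5 * Q * M) * H" using \<nu>_sum H0 by (intro mult_right_mono) auto
  finally have "(5 * Q * M) * (real D + 1) \<le> (5 * Q * M) * H" by (simp add: algebra_simps)
  then have "D + 1 \<le> H" using Q(1) large(2) by (subst (asm) mult_le_cancel_left_pos) auto
  then have "card R * (real D + 1) \<le> card R * H" by (intro mult_left_mono) auto
  \<comment> \<open>The excess of \<open>D + 1\<close> over \<open>D\<close> leaves one copy of
    \<open>card R\<close> after cancellation, bounded by \<open>card P\<close>.\<close>
  also have "\<dots> \<le> card P + card R * D"
    unfolding H_def using larger_sieve[OF finP P(1) R] False by simp
  finally have "card R \<le> real (card P)" by (simp add: algebra_simps)
  moreover have "card P \<le> card {1..Q}" by (intro card_mono P) simp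
  ultimately show ?thesis by simp
qed

subsection \<open>Automata and prime patterns\<close>

text \<open>The low block consists of exactly \<open>k\<close> digits, padded with zeros when
  \<open>r\<close> is short. The padding survives because \<open>n > 0\<close> supplies a nonzero
  digit above it.\<close>

lemma base_repr_append:
  assumes q: "q \<ge> 2" and n: "n > 0"
  shows "r < q ^ k \<Longrightarrow> base_repr q (r + q ^ k * n) = map (\<lambda>i. r div q ^ i mod q) [0..<k] @ base_repr q n"
proof (induction k arbitrary: r)
  case (Suc k)
  have r: "r div q < q ^ k" using Suc.prems q by (intro less_mult_imp_div_less) (simp add: mult.commute)
  define m where "m = r + q ^ Suc k * n"
  have m_eq: "m = r + (q ^ k * n) * q" unfolding m_def by simp
  have "m div q = r div q + q ^ k * n"
    unfolding m_eq using q by (subst div_mult_self1) simp_all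
  moreover have "m mod q = r mod q"
    unfolding m_eq by (rule mod_mult_self1)
  moreover have "m > 0" unfolding m_def using q n by simp
  ultimately have "base_repr q m = r mod q # base_repr q (r div q + q ^ k * n)"
    using q by (subst base_repr.simps) simp
  also have "base_repr q (r div q + q ^ k * n) = map (\<lambda>i. r div q div q ^ i mod q) [0..<k] @ base_repr q n"
    by (rule Suc.IH[OF r])
  also have "r mod q # map (\<lambda>i. r div q div q ^ i mod q) [0..<k] @ base_repr q n =
      map (\<lambda>i. r div q ^ i mod q) [0..<Suc k] @ base_repr q n"
    by (simp add: map_upt_Suc div_mult2_eq del: upt_Suc)
  finally show ?case unfolding m_def .
qed simp

text \<open>Division by \<open>N\<close> writes a prime as \<open>r + N * n\<close>. The summands
  \<open>N\<close> and 1 account for the quotient 0 and for the endpoint \<open>N * M\<close>, both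
  outside the range of \<open>n\<close>.\<close>

lemma sum_card_primes_in_progressions:
  fixes N M :: nat
  assumes N: "N > 0"
  shows "card {p. prime p \<and> p \<le> N * M} \<le> N + (\<Sum>r<N. card {n\<in>{1..<M}. prime (r + N * n)}) + 1"
proof -
  let ?S = "\<lambda>r. {n\<in>{1..<M}. prime (r + N * n)}"
  have "{p. prime p \<and> p \<le> N * M} \<subseteq> {..<N} \<union> (\<lambda>(r, n). r + N * n) ` (SIGMA r:{..<N}. ?S r) \<union> {N * M}"
  proof
    fix p assume p: "p \<in> {p. prime p \<and> p \<le> N * M}"
    have eq: "p mod N + N * (p div N) = p" by simp
    show "p \<in> {..<N} \<union> (\<lambda>(r, n). r + N * n) ` (SIGMA r:{..<N}. ?S r) \<union> {N * M}"
    proof (cases "p < N \<or> p = N * M")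
      case False
      then have "1 \<le> p div N" "p div N < M"
        using p N by (auto simp: div_less_iff_less_mult mult.commute Suc_le_eq div_greater_zero_iff)
      then have "(p mod N, p div N) \<in> (SIGMA r:{..<N}. ?S r)" using N p eq by simp
      then have "(\<lambda>(r, n). r + N * n) (p mod N, p div N) \<in> (\<lambda>(r, n). r + N * n) ` (SIGMA r:{..<N}. ?S r)"
        by (rule imageI)
      then show ?thesis using eq by simp
    qed auto
  qed
  then have "card {p. prime p \<and> p \<le> N * M} \<le> card ({..<N} \<union> (\<lambda>(r, n). r + N * n) ` (SIGMA r:{..<N}. ?S r) \<union> {N * M})"
    by (intro card_mono) auto
  also have "\<dots> \<le> card {..<N} + card ((\<lambda>(r, n). r + N * n) ` (SIGMA r:{..<N}. ?S r)) + card {N * M}"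
    by (intro order_trans[OF card_Un_le] add_mono card_Un_le) simp
  also have "\<dots> \<le> N + card (SIGMA r:{..<N}. ?S r) + 1"
    by (intro add_mono card_image_le) auto
  also have "card (SIGMA r:{..<N}. ?S r) = (\<Sum>r<N. card (?S r))" by simp
  finally show ?thesis .
qed

lemma card_le_mult_of_fibers:
  assumes "finite T" "f ` G \<subseteq> T" "finite G" "\<And>s. s \<in> T \<Longrightarrow> card {r\<in>G. f r = s} \<le> b"
  shows "card G \<le> b * card T"
proof -
  have "G = (\<Union>s\<in>T. {r\<in>G. f r = s})" using assms(2) by auto
  then have "card G \<le> (\<Sum>s\<in>T. card {r\<in>G. f r = s})"
    using card_UN_le[OF assms(1), of "\<lambda>s. {r\<in>G. f r = s}"] by simp
  also have "\<dots> \<le> (\<Sum>s\<in>T. b)" by (intro sum_mono assms(4))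
  finally show ?thesis by (simp add: mult.commute)
qed

text \<open>Residues are sorted by the state reached after their \<open>k\<close> digits. Within one
  such class acceptance of \<open>r + q ^ k * n\<close> depends on \<open>n\<close> alone, so the
  prime patterns coincide and \<open>b\<close> bounds the class.\<close>

lemma card_states_ge_patterns:
  fixes M :: "'s dfa" and q k L b :: nat and G :: "nat set"
  assumes q: "q \<ge> 2" and M: "is_dfa q M" "recognizes_upto q M {p. prime p} x"
    and x: "real (q ^ k * L) \<le> x"
    and G: "G \<subseteq> {..<q ^ k}"
    and b: "\<And>R. R \<subseteq> G \<Longrightarrow>
      (\<And>r r' n. r \<in> R \<Longrightarrow> r' \<in> R \<Longrightarrow> n \<in> {1..<L} \<Longrightarrow> prime (r + q ^ k * n) \<longleftrightarrow> prime (r' + q ^ k * n)) \<Longrightarrow>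
      card R \<le> b"
  shows "card G \<le> b * card (states M)"
proof (rule card_le_mult_of_fibers)
  define w where "w r = map (\<lambda>i. r div q ^ i mod q) [0..<k]" for r
  let ?f = "\<lambda>r. fold (trans M) (w r) (start M)"
  show "finite (states M)" using M(1) by (simp add: is_dfa_def)
  show "finite G" by (rule finite_subset[OF G]) simp
  show "?f ` G \<subseteq> states M"
    using q M(1) by (auto intro!: fold_trans_in_states[OF M(1)] simp: w_def is_dfa_def)
  fix s assume "s \<in> states M"
  show "card {r\<in>G. ?f r = s} \<le> b"
  proof (rule b)
    have key: "prime (r + q ^ k * n) \<longleftrightarrow> fold (trans M) (base_repr q n) s \<in> accepting M"
      if r: "r \<in> {r\<in>G. ?f r = s}" and n: "n \<in> {1..<L}" for r n
    proof -
      have r': "r < q ^ k" using r G by auto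
      have "r + q ^ k * n < q ^ k * (n + 1)" using r' by simp
      also have "\<dots> \<le> q ^ k * L" using n by (intro mult_left_mono) auto
      finally have "real (r + q ^ k * n) < real (q ^ k * L)" by (simp only: of_nat_less_iff)
      then have "real (r + q ^ k * n) \<le> x" using x by linarith
      moreover have "1 \<le> r + q ^ k * n" using n q by (simp add: Suc_le_eq)
      ultimately have "prime (r + q ^ k * n) \<longleftrightarrow> accepts M (base_repr q (r + q ^ k * n))"
        using M(2) by (simp add: recognizes_upto_def)
      also have "base_repr q (r + q ^ k * n) = w r @ base_repr q n"
        unfolding w_def using n by (intro base_repr_append[OF q _ r']) simp
      finally show ?thesis using r by (simp add: accepts_def)
    qed
    fix r r' n assume "r \<in> {r\<in>G. ?f r = s}" "r' \<in> {r\<in>G. ?f r = s}" "n \<in> {1..<L}"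
    then show "prime (r + q ^ k * n) \<longleftrightarrow> prime (r' + q ^ k * n)" by (simp add: key)
  qed auto
qed

section \<open>Choice of parameters at powers of the base\<close>

text \<open>The sieve level is \<open>Q = q ^ h\<close>, the pattern length \<open>L = Q ^ 3\<close>
  is the least that the variance sieve admits, and \<open>N * L = q ^ K\<close>. By Chebyshev at
  least \<open>N / (2 * q * K)\<close> residues have dense patterns (the set \<open>G\<close>), and
  at most \<open>Q\<close> of them share a state; the loss is \<open>2 * q * K * Q * L\<close>. The
  condition \<open>K ^ 4 \<le> q ^ h\<close> makes \<open>Q\<close> large enough for the sieves, the
  condition on \<open>K\<close> keeps \<open>h\<close> small.\<close>

lemma card_states_recognizing_primes_ge:
  fixes M :: "'s dfa" and q h K :: nat
  assumes q: "q \<ge> 2" and h: "h \<ge> 1" and K: "13 * q\<^sup>2 * h \<le> K" and Kh: "K ^ 4 \<le> q ^ h"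
    and M: "is_dfa q M" "recognizes_upto q M {p. prime p} x" and x: "real (q ^ K) \<le> x"
  shows "q ^ K \<le> card (states M) * (2 * q * K * q ^ (4 * h))"
proof -
  define Q where "Q = q ^ h"
  define L where "L = Q ^ 3"
  define k where "k = K - 3 * h"
  define N where "N = q ^ k"
  define S where "S r = {n\<in>{1..<L}. prime (r + N * n)}" for r
  \<comment> \<open>Chebyshev gives about \<open>L / (q * K)\<close> primes per residue on average;
    the threshold is a quarter of that.\<close>
  define G where "G = {r\<in>{..<N}. L \<le> 4 * q * K * card (S r)}"
  have "1 * h \<le> q\<^sup>2 * h" using q by (intro mult_right_mono) auto
  then have K_h: "13 * h \<le> K" using K by linarith
  have "q\<^sup>2 * 1 \<le> q\<^sup>2 * h" using h by (intro mult_left_mono) auto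
  then have K_q2: "13 * q\<^sup>2 \<le> K" using K by linarith
  moreover have "2 * q \<le> q\<^sup>2" unfolding power2_eq_square using q by (intro mult_right_mono) auto
  ultimately have K_q: "26 * q \<le> K" by linarith
  then have K52: "K \<ge> 52" using q by linarith
  have NL: "N * L = q ^ K"
    unfolding N_def L_def Q_def k_def using K_h by (simp flip: power_add power_mult)
  have N0: "N > 0" unfolding N_def using q by simp
  have Q0: "Q > 0" unfolding Q_def using q by simp
  have QL: "Q \<le> L" unfolding L_def using Q0 power_increasing[of 1 3 Q] by simp
  have QN: "Q \<le> N" unfolding Q_def N_def k_def using K_h q by (intro power_increasing) auto
  have KQ: "K ^ 4 \<le> Q" using Kh by (simp add: Q_def)
  have K2_K4: "K\<^sup>2 \<le> K ^ 4" using K52 by (intro power_increasing) auto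
  have L_ge: "16 * K * q \<le> L"
  proof -
    have "16 * K * q \<le> 26 * q * K" by simp
    also have "\<dots> \<le> K\<^sup>2" using K_q by (simp add: power2_eq_square)
    finally show ?thesis using KQ QL K2_K4 by linarith
  qed
  have many: "N \<le> 2 * q * K * card G"
  proof -
    let ?T = "\<Sum>r<N. card (S r)"
    have "card {p. prime p \<and> p \<le> q ^ K} \<le> N + ?T + 1"
      using sum_card_primes_in_progressions[OF N0, of L] unfolding NL S_def .
    then have "K * q * (card {p. prime p \<and> p \<le> q ^ K} + 1) \<le> K * q * (N + ?T + 1 + 1)"
      by (intro mult_left_mono add_right_mono) simp_all
    moreover have "q ^ K \<le> K * q * (card {p. prime p \<and> p \<le> q ^ K} + 1) + 1"
      using q K52 by (intro card_primes_le_power_ge) auto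
    ultimately have "N * L \<le> (K * q * (N + 2) + 1) + K * q * ?T"
      unfolding NL by (simp add: algebra_simps)
    moreover have "4 * (K * q * ?T) \<le> 4 * q * K * (card G * L) + N * L"
    proof -
      have "4 * (K * q * ?T) = (\<Sum>r<N. 4 * q * K * card (S r))"
        by (simp add: sum_distrib_left mult_ac)
      \<comment> \<open>Residues in \<open>G\<close> receive the trivial bound
        \<open>card (S r) \<le> L\<close>, all others lie below the threshold.\<close>
      also have "\<dots> \<le> (\<Sum>r<N. (if r \<in> G then 4 * q * K * L else 0) + L)"
      proof (intro sum_mono)
        fix r assume r: "r \<in> {..<N}"
        have "card (S r) \<le> card {1..<L}" unfolding S_def by (intro card_mono) auto
        then have "4 * q * K * card (S r) \<le> 4 * q * K * L" by (intro mult_left_mono) auto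
        then show "4 * q * K * card (S r) \<le> (if r \<in> G then 4 * q * K * L else 0) + L"
        proof (cases "r \<in> G")
          case False
          then have "\<not> L \<le> 4 * q * K * card (S r)" using r by (simp add: G_def)
          with False show ?thesis by simp
        qed (simp only: if_True trans_le_add1)
      qed
      also have "\<dots> = (\<Sum>r\<in>G. 4 * q * K * L) + N * L"
        by (simp add: sum.distrib sum.If_cases G_def Int_def)
      finally show ?thesis by (simp add: mult_ac)
    qed
    moreover have "4 * (K * q * (N + 2) + 1) \<le> N * L"
    proof -
      have "K * q * (N + 2) \<le> K * q * (3 * N)" using N0 by (intro mult_left_mono) auto
      also have "\<dots> = 3 * (K * q * N)" by simp
      finally have "K * q * (N + 2) \<le> 3 * (K * q * N)" .
      moreover have "1 \<le> K * q * N" using K52 q N0 by (simp add: Suc_le_eq)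
      ultimately have "4 * (K * q * (N + 2) + 1) \<le> 4 * (3 * (K * q * N) + K * q * N)"
        by (intro mult_left_mono add_mono) simp_all
      also have "\<dots> = N * (16 * K * q)" by simp
      also have "\<dots> \<le> N * L" using L_ge by (intro mult_left_mono) auto
      finally show ?thesis .
    qed
    \<comment> \<open>Here \<open>a = N * L\<close>, \<open>u\<close> is the error of Chebyshev's
      bound, \<open>t\<close> comes from the primes counted, and \<open>v\<close> is the share of
      \<open>G\<close>. The error and the sparse residues take at most a quarter of \<open>a\<close>
      each, so half is left for \<open>G\<close>.\<close>
    moreover have "2 * a \<le> v" if "a \<le> u + t" "4 * t \<le> v + a" "4 * u \<le> a" for a t u v :: nat
      using that by linarith
    ultimately have "2 * (N * L) \<le> 4 * q * K * (card G * L)" by blast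
    then have "N * L \<le> (2 * q * K * card G) * L" by (simp add: mult_ac)
    then show ?thesis using QL Q0 by simp
  qed
  have fiber: "card R \<le> Q"
    if R: "R \<subseteq> G" and same: "\<And>r r' n. r \<in> R \<Longrightarrow> r' \<in> R \<Longrightarrow> n \<in> {1..<L} \<Longrightarrow>
      prime (r + N * n) \<longleftrightarrow> prime (r' + N * n)" for R
  proof (cases "R = {}")
    case False
    then obtain r0 where r0: "r0 \<in> R" by blast
    \<comment> \<open>Primes dividing \<open>q\<close> are removed to make \<open>N\<close>
      invertible modulo \<open>p\<close>. They lie in \<open>{1..q}\<close>, so at most
      \<open>q\<close> are lost.\<close>
    define P where "P = {p. prime p \<and> p \<le> Q \<and> \<not> p dvd q}"
    have "finite {p. prime p \<and> p \<le> Q}" by simp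
    then have finP: "finite P" by (rule rev_finite_subset) (auto simp: P_def)
    have "{p. prime p \<and> p \<le> Q} \<subseteq> P \<union> {1..q}"
      using q by (auto simp: P_def prime_gt_0_nat Suc_le_eq intro: dvd_imp_le)
    then have "card {p. prime p \<and> p \<le> Q} \<le> card (P \<union> {1..q})" using finP by (intro card_mono) auto
    also have "\<dots> \<le> card P + q" using card_Un_le[of P "{1..q}"] by simp
    finally have "h * q * (card {p. prime p \<and> p \<le> Q} + 1) \<le> h * q * (card P + q + 1)"
      by (intro mult_left_mono) auto
    moreover have "Q \<le> h * q * (card {p. prime p \<and> p \<le> Q} + 1) + 1"
      unfolding Q_def using q h by (rule card_primes_le_power_ge)
    \<comment> \<open>The removed primes and the additive terms cost at most half of
      \<open>Q\<close>.\<close>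
    moreover have "2 * (h * q * (q + 1) + 1) \<le> Q"
    proof -
      have "h * q \<le> h * q * q" "1 \<le> h * q * q" using q h by (simp_all add: Suc_le_eq)
      moreover have "13 * (h * q * q) \<le> K" using K by (simp add: power2_eq_square mult_ac)
      moreover have "K \<le> K ^ 4" using K52 power_increasing[of 1 4 K] by simp
      moreover have "2 * (h * q * (q + 1) + 1) = 2 * (h * q * q) + 2 * (h * q) + 2" by simp
      ultimately show ?thesis using KQ by linarith
    qed
    ultimately have "Q \<le> 2 * h * q * card P" by (simp add: algebra_simps)
    then have "Q\<^sup>2 \<le> (2 * h * q * card P)\<^sup>2" by (intro power_mono) auto
    then have QQ: "Q * Q \<le> 4 * h\<^sup>2 * q\<^sup>2 * (card P)\<^sup>2"
      by (simp add: power_mult_distrib power2_eq_square mult_ac)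
    \<comment> \<open>With \<open>D = q * K\<close>, \<open>card P \<ge> Q / (2 * h * q)\<close> and
      \<open>card (S r0) \<ge> L / (4 * q * K)\<close>, the size condition of the sieve lemma
      reduces to this inequality.\<close>
    have "4 * h\<^sup>2 * q\<^sup>2 * (20 * q * K * (q * K + 1)) \<le> Q"
    proof -
      have "4 * h\<^sup>2 * q\<^sup>2 * (20 * q * K * (q * K + 1)) \<le> 4 * h\<^sup>2 * q\<^sup>2 * (20 * q * K * (2 * q * K))"
        using q K52 by (intro mult_left_mono) (auto simp: Suc_le_eq)
      \<comment> \<open>The product of the constants is 4 * 20 * 2 = 160, and 13 is the least
        integer whose square reaches it.\<close>
      also have "\<dots> \<le> (13 * q\<^sup>2 * h)\<^sup>2 * K\<^sup>2"
        by (simp add: power_mult_distrib power2_eq_square mult_ac)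
      also have "\<dots> \<le> K\<^sup>2 * K\<^sup>2" by (intro mult_right_mono power_mono K) auto
      also have "\<dots> = K ^ 4" by (simp flip: power_add)
      finally show ?thesis using KQ by linarith
    qed
    then have "4 * h\<^sup>2 * q\<^sup>2 * (20 * q * K * (q * K + 1)) * Q \<le> 4 * h\<^sup>2 * q\<^sup>2 * (card P)\<^sup>2"
      using mult_right_mono[of _ Q Q] QQ by (meson order_trans zero_le)
    then have "(4 * h\<^sup>2 * q\<^sup>2) * (20 * q * K * (q * K + 1) * Q) \<le> (4 * h\<^sup>2 * q\<^sup>2) * (card P)\<^sup>2"
      by (simp only: mult.assoc)
    moreover have "4 * h\<^sup>2 * q\<^sup>2 > 0" using q h by simp
    ultimately have P_large: "20 * q * K * (q * K + 1) * Q \<le> (card P)\<^sup>2"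
      using mult_le_cancel1 by blast
    have "L \<le> 4 * q * K * card (S r0)" using r0 R by (auto simp: G_def)
    then have "5 * Q * (q * K + 1) * L \<le> 5 * Q * (q * K + 1) * (4 * q * K * card (S r0))"
      by (intro mult_left_mono) auto
    also have "\<dots> = 20 * q * K * (q * K + 1) * Q * card (S r0)" by (simp add: mult_ac)
    also have "\<dots> \<le> (card P)\<^sup>2 * card (S r0)" using P_large by (intro mult_right_mono) auto
    finally have large: "5 * Q * L * (q * K + 1) \<le> (card P)\<^sup>2 * card (S r0)" by (simp add: mult_ac)
    have N_le: "N \<le> 2 ^ (q * K)"
    proof -
      have "N \<le> q ^ K" unfolding N_def k_def using q by (intro power_increasing) auto
      also have "\<dots> \<le> (2 ^ q) ^ K" by (intro power_mono) (simp_all add: less_imp_le)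
      finally show ?thesis by (simp add: power_mult)
    qed
    show ?thesis
    proof (rule card_common_prime_translates_le[where g = N and S = "S r0" and M = L and D = "q * K"])
      show "prime p" "coprime N p" if "p \<in> P" for p
        using that by (auto simp: P_def N_def prime_imp_coprime coprime_commute)
      show "P \<subseteq> {1..Q}" by (auto simp: P_def prime_gt_0_nat Suc_le_eq)
      show "R \<subseteq> {..<2 ^ (q * K)}" using R N_le by (auto simp: G_def)
      show "S r0 \<subseteq> {1..<L}" by (auto simp: S_def)
      show "prime (r + N * n)" if "r \<in> R" "n \<in> S r0" for r n
        using same[OF r0 that(1), of n] that(2) by (auto simp: S_def)
      show "L > 0" using QL Q0 by linarith
    qed (use Q0 QN large in \<open>simp_all add: L_def\<close>)
  qed simp
  have "card G \<le> Q * card (states M)"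
  proof (rule card_states_ge_patterns[OF q M])
    show "real (q ^ k * L) \<le> x" using x NL by (simp add: N_def)
    show "G \<subseteq> {..<q ^ k}" by (auto simp: G_def N_def)
    show "card R \<le> Q" if "R \<subseteq> G" "\<And>r r' n. r \<in> R \<Longrightarrow> r' \<in> R \<Longrightarrow> n \<in> {1..<L} \<Longrightarrow>
      prime (r + q ^ k * n) \<longleftrightarrow> prime (r' + q ^ k * n)" for R
      using fiber[of R] that unfolding N_def by blast
  qed
  then have "2 * q * K * card G \<le> 2 * q * K * (Q * card (states M))" by (intro mult_left_mono) auto
  \<comment> \<open>Multiplying by \<open>L = Q ^ 3\<close> restores \<open>q ^ K\<close> on the
    left and produces \<open>Q ^ 4\<close> on the right.\<close>
  then have "N * L \<le> 2 * q * K * (Q * card (states M)) * L"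
    using many by (intro mult_right_mono order_trans[OF many]) simp_all
  also have "\<dots> = card (states M) * (2 * q * K * Q ^ 4)"
    by (simp add: L_def power3_eq_cube power4_eq_xxxx mult_ac)
  also have "Q ^ 4 = q ^ (4 * h)" by (simp add: Q_def mult.commute flip: power_mult)
  finally show ?thesis unfolding NL .
qed

section \<open>Passage to all large real numbers\<close>

theorem theorem1:
  fixes q :: nat
  assumes "q \<ge> 2"
  shows "\<exists>c::real. c > 0 \<and>
    (\<forall>\<^sub>F x::real in at_top.
       real (automaticity q {p. prime p} x) \<ge> x * exp (- c * (ln (ln x))\<^sup>2 * ln (ln (ln x))))"
\<comment> \<open>The argument yields \<open>x / (B * (ln x / ln 2) ^ 17)\<close>, which beats the
  required bound already with \<open>c = 1\<close>.\<close>
proof (intro exI[of _ 1] conjI)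
  define C where "C = 13 * (real q)\<^sup>2"
  have "\<forall>\<^sub>F K::nat in sequentially. C * (1 + 4 * ln (real K) / ln 2) \<le> real K"
    by real_asymp
  then obtain K0 where K0: "\<And>K. K \<ge> K0 \<Longrightarrow> C * (1 + 4 * ln (real K) / ln 2) \<le> real K"
    by (auto simp: eventually_sequentially)
  \<comment> \<open>Of the six factors \<open>q\<close>, one comes from
    \<open>x < q * q ^ K\<close>, one from \<open>2 * q * K\<close>, and four from
    \<open>q ^ (4 * (j + 1))\<close>, which is at most \<open>(q * K ^ 4) ^ 4\<close>. The same
    product contains \<open>K\<close> to the power 1 + 16 = 17.\<close>
  define B where "B = 2 * (real q) ^ 6"
  have "\<forall>\<^sub>F x::real in at_top. B * (ln x / ln 2) ^ 17 \<le> exp ((ln (ln x))\<^sup>2 * ln (ln (ln x)))"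
    by real_asymp
  \<comment> \<open>The exponent \<open>K0 + 2\<close> forces \<open>K \<ge> K0 + 1\<close>, so
    \<open>K\<close> is positive as well as beyond \<open>K0\<close>.\<close>
  moreover have "\<forall>\<^sub>F x in at_top. real (q ^ (K0 + 2)) \<le> x" by (rule eventually_ge_at_top)
  ultimately show "\<forall>\<^sub>F x::real in at_top.
      real (automaticity q {p. prime p} x) \<ge> x * exp (- 1 * (ln (ln x))\<^sup>2 * ln (ln (ln x)))"
  proof eventually_elim
    case (elim x)
    let ?A = "automaticity q {p. prime p} x"
    have x_floor: "q ^ (K0 + 2) \<le> nat \<lfloor>x\<rfloor>" using elim(2) by (simp add: le_nat_floor)
    have "1 \<le> q ^ (K0 + 2)" using assms by (intro one_le_power) linarith
    then have "1 \<le> nat \<lfloor>x\<rfloor>" using x_floor by linarith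
    then obtain K where K: "q ^ K \<le> nat \<lfloor>x\<rfloor>" "nat \<lfloor>x\<rfloor> < q ^ (K + 1)"
      using ex_power_ivl1[OF assms] by blast
    have "q ^ (K0 + 2) < q ^ (K + 1)" using K(2) x_floor by linarith
    then have "K0 + 2 < K + 1" using assms by (intro power_less_imp_less_exp[of q "K0 + 2" "K + 1"]) linarith+
    then have K_ge: "K0 + 1 \<le> K" by linarith
    have x_pos: "x > 0" using \<open>1 \<le> nat \<lfloor>x\<rfloor>\<close> by linarith
    have x_ge: "real (q ^ K) \<le> x" using K(1) x_pos by linarith
    have "x < real (q ^ (K + 1))" using K(2) x_pos by linarith
    then have x_less: "x < real q * real q ^ K" by simp
    have "K ^ 4 \<ge> 1" using K_ge by simp
    \<comment> \<open>The lemma is applied with \<open>h = j + 1\<close>, the least exponent with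
      \<open>K ^ 4 < q ^ h\<close>. It is logarithmic in \<open>K\<close>, so its condition on
      \<open>K\<close> holds for large \<open>K\<close>.\<close>
    then obtain j where j: "q ^ j \<le> K ^ 4" "K ^ 4 < q ^ (j + 1)"
      using ex_power_ivl1[of q "K ^ 4"] assms by auto
    have "real (2 ^ j) \<le> real (K ^ 4)"
    proof -
      have "2 ^ j \<le> q ^ j" using assms by (intro power_mono) auto
      then show ?thesis using j(1) by (simp only: of_nat_le_iff)
    qed
    then have "ln (2 ^ j) \<le> ln (real K ^ 4)" using K_ge by (subst ln_le_cancel_iff) auto
    then have "real j \<le> 4 * ln (real K) / ln 2"
      using K_ge by (simp add: ln_realpow field_simps)
    then have "C * real (j + 1) \<le> C * (1 + 4 * ln (real K) / ln 2)"
      by (intro mult_left_mono) (auto simp: C_def)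
    also have "\<dots> \<le> real K" using K_ge by (intro K0) simp
    finally have "real (13 * q\<^sup>2 * (j + 1)) \<le> real K" by (simp add: C_def algebra_simps)
    then have Kj: "13 * q\<^sup>2 * (j + 1) \<le> K" by (simp only: of_nat_le_iff)
    obtain M :: "nat dfa" where M: "is_dfa q M" "recognizes_upto q M {p. prime p} x" "card (states M) = ?A"
      using automaticity_attained[OF assms] by blast
    have "q ^ K \<le> ?A * (2 * q * K * q ^ (4 * (j + 1)))"
      using card_states_recognizing_primes_ge[OF assms _ Kj _ M(1,2) x_ge] j(2) M(3) by simp
    then have "real (q ^ K) \<le> real (?A * (2 * q * K * q ^ (4 * (j + 1))))" by (simp only: of_nat_le_iff)
    moreover have power_eq: "real q ^ (4 * (j + 1)) = (q * real q ^ j) ^ 4"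
      by (simp add: power_mult_distrib power_add algebra_simps flip: power_mult)
    ultimately have bound: "real q ^ K \<le> ?A * (2 * q * K * (q * real q ^ j) ^ 4)"
      by (simp only: power_eq of_nat_mult of_nat_power of_nat_numeral)
    have "real q ^ j \<le> real K ^ 4" using j(1) by (metis of_nat_le_iff of_nat_power)
    then have "(q * real q ^ j) ^ 4 \<le> (q * real K ^ 4) ^ 4" by (intro power_mono mult_left_mono) auto
    then have "real q * (?A * (2 * q * K * (q * real q ^ j) ^ 4)) \<le> real q * (?A * (2 * q * K * (q * real K ^ 4) ^ 4))"
      by (intro mult_left_mono) auto
    also have "\<dots> = ?A * (B * real K ^ 17)"
      by (simp add: B_def power_mult_distrib flip: power_mult) (simp add: eval_nat_numeral)
    finally have "x \<le> ?A * (B * real K ^ 17)"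
      using x_less mult_left_mono[OF bound, of "real q"] by linarith
    also have "\<dots> \<le> ?A * (B * (ln x / ln 2) ^ 17)"
    proof -
      have "2 ^ K \<le> real (q ^ K)" using assms by (simp add: power_mono)
      then have "2 ^ K \<le> x" using x_ge by linarith
      then have "ln (2 ^ K) \<le> ln x" using x_pos by (subst ln_le_cancel_iff) auto
      then have "real K \<le> ln x / ln 2" by (simp add: ln_realpow field_simps)
      then show ?thesis by (intro mult_left_mono power_mono) (auto simp: B_def)
    qed
    also have "\<dots> \<le> ?A * exp ((ln (ln x))\<^sup>2 * ln (ln (ln x)))"
      using elim(1) by (intro mult_left_mono) auto
    finally show ?case by (simp add: exp_minus field_simps)
  qed
qed simp

end
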